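(* Let $\Gamma=(V,T,\mathbf{s},\mathbf{r})$ be a network, let $E(Q_\Gamma)$ be the set of all idempotents of $Q_\Gamma$ and let $\le$ be the natural partial order on $Q_\Gamma$. Then the following hold. (i) For $\alpha\in RLP(\Gamma)$, the idempotent $[\alpha\alpha^{-1}]$ is maximal in $E(Q_\Gamma)$ with respect to $\le$ if and only if $\alpha\in T^0$. (ii) For $\alpha\in RLP(\Gamma)\setminus T^0$, the idempotent $[\alpha\alpha^{-1}]$ is maximal in $E=E(Q_\Gamma)\setminus\{[A]:A\in T^0\}$ with respect to $\le$ if and only if $\alpha\in T$.
   Context: A network $\Gamma=(V,T,\mathbf{s},\mathbf{r})$ consists of a set $V$ of vertices, a set $T$ of relations, and maps $\mathbf{s},\mathbf{r}:T\to\mathcal{P}(V)$ such that for every $t\in T$ the sets $\mathbf{s}(t)$ and $\mathbf{r}(t)$ are disjoint non-empty subsets of $V$; $V$ and $T$ are finite or countably infinite. A vertex $v$ is identified with the singleton $\{v\}$. Put $T^0=\{A\subseteq V: A=\mathbf{s}(t)\text{ or }A=\mathbf{r}(t)\text{ for some }t\in T\}\cup V$, and set $\mathbf{s}(A)=A=\mathbf{r}(A)$ for $A\in T^0$. For each $t\in T$ let $t^{-1}$ be a formal symbol with $\mathbf{s}(t^{-1})=\mathbf{r}(t)$, $\mathbf{r}(t^{-1})=\mathbf{s}(t)$; put $A^{-1}=A$ for $A\in T^0$ and $T^{-1}=\{t^{-1}:t\in T\}$. The symbol sets $T$, $T^0$, $T^{-1}$, $\{0\}$ are pairwise disjoint.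 $Q_\Gamma$ is the semigroup generated by $X=T\cup T^0\cup T^{-1}\cup\{0\}$ subject to the relations: (NR1) $\mathbf{s}(t)t=t=t\mathbf{r}(t)$ for $t\in T\cup T^0\cup T^{-1}$; (NR2) $t_1t_2=0$ if $\mathbf{r}(t_1)\cap\mathbf{s}(t_2)=\emptyset$, for $t_1,t_2\in T\cup T^0\cup T^{-1}$; (NR3) $t_1^{-1}t_2=0$ if $t_1\neq t_2$, for $t_1,t_2\in T$; (NR4) $t^{-1}t=\mathbf{r}(t)$ for $t\in T$; (NR5) $t^{-1}A=0$ if $\mathbf{s}(t)\neq A$, for $t\in T$, $A\in T^0$; (NR6) $0x=0=x0$ for all $x\in X$. $[w]$ denotes the class in $Q_\Gamma$ of a word $w$. $RLP(\Gamma)$ is the set of (non-zero) reduced linear paths: finite non-empty sequences $\alpha=t_1\cdots t_n$ with $t_i\in T\cup T^0$, $\mathbf{r}(t_i)=\mathbf{s}(t_{i+1})$ for $1\le i<n$ (linear), and $t_i\neq\mathbf{s}(t_{i+1})$, $t_{i+1}\neq\mathbf{r}(t_i)$ for $1\le i<n$ (reduced); equivalently, $RLP(\Gamma)=\{t_1\cdots t_n:t_i\in T,\ \mathbf{r}(t_i)=\mathbf{s}(t_{i+1})\}\cup T^0$. For $\alpha=t_1\cdots t_n$, $\alpha^{-1}=t_n^{-1}\cdots t_1^{-1}$. The idempotents of $Q_\Gamma$ are $[0]$ and the $[\alpha\alpha^{-1}]$ with $\alpha\in RLP(\Gamma)$. The natural partial order on a semigroup $S$: $a\le b$ iff $a=xb=by$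 and $xa=a$ for some $x,y\in S^1$. On idempotents: $e\le f$ iff $e=ef=fe$. *)

theory Defs
  imports "HOL-Algebra.Congruence" "HOL-Library.Countable_Set"
begin

section \<open>Semigroups with a carrier\<close>

record 'a sgrp = "'a partial_object" +
  sgmult :: "'a \<Rightarrow> 'a \<Rightarrow> 'a" (infixl \<open>\<cdot>\<index>\<close> 70)

definition has_identity :: "('a, 'm) sgrp_scheme \<Rightarrow> bool" where
  "has_identity S \<longleftrightarrow>
     (\<exists>e\<in>carrier S. \<forall>x\<in>carrier S. e \<cdot>\<^bsub>S\<^esub> x = x \<and> x \<cdot>\<^bsub>S\<^esub> e = x)"

text \<open>The monoid \<open>S\<^sup>1\<close>: it is \<open>S\<close> itself (embedded by \<^const>\<open>Some\<close>) if \<open>S\<close> has an identity,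
  and otherwise \<open>S\<close> with the new identity \<^const>\<open>None\<close>.\<close>

definition adjoin_one :: "('a, 'm) sgrp_scheme \<Rightarrow> 'a option sgrp" where
  "adjoin_one S =
     \<lparr>carrier = (if has_identity S then Some ` carrier S else insert None (Some ` carrier S)),
      sgmult = (\<lambda>x y. case x of None \<Rightarrow> y
                 | Some a \<Rightarrow> (case y of None \<Rightarrow> x | Some b \<Rightarrow> Some (a \<cdot>\<^bsub>S\<^esub> b)))\<rparr>"

definition nat_le :: "('a, 'm) sgrp_scheme \<Rightarrow> 'a \<Rightarrow> 'a \<Rightarrow> bool" where
  "nat_le S a b \<longleftrightarrow> a \<in> carrier S \<and> b \<in> carrier S \<and>
     (\<exists>x\<in>carrier (adjoin_one S). \<exists>y\<in>carrier (adjoin_one S).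
        Some a = x \<cdot>\<^bsub>adjoin_one S\<^esub> Some b \<and>
        Some a = Some b \<cdot>\<^bsub>adjoin_one S\<^esub> y \<and>
        x \<cdot>\<^bsub>adjoin_one S\<^esub> Some a = Some a)"

definition idempotents :: "('a, 'm) sgrp_scheme \<Rightarrow> 'a set" where
  "idempotents S = {e \<in> carrier S. e \<cdot>\<^bsub>S\<^esub> e = e}"

definition maximal_in :: "('a \<Rightarrow> 'a \<Rightarrow> bool) \<Rightarrow> 'a set \<Rightarrow> 'a \<Rightarrow> bool" where
  "maximal_in le E e \<longleftrightarrow> e \<in> E \<and> (\<forall>f\<in>E. le e f \<longrightarrow> f = e)"


section \<open>Semigroup presentations\<close>

definition words :: "'x set \<Rightarrow> 'x list set" where
  "words X = {w \<in> lists X. w \<noteq> []}"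

text \<open>The congruence on the free semigroup \<open>words X\<close> generated by the relations \<open>R\<close>.\<close>

inductive_set pres_cong :: "'x set \<Rightarrow> ('x list \<times> 'x list) set \<Rightarrow> ('x list \<times> 'x list) set"
  for X R where
  rel: "(u, v) \<in> R \<Longrightarrow> u \<in> words X \<Longrightarrow> v \<in> words X \<Longrightarrow> (u, v) \<in> pres_cong X R"
| refl: "u \<in> words X \<Longrightarrow> (u, u) \<in> pres_cong X R"
| sym: "(u, v) \<in> pres_cong X R \<Longrightarrow> (v, u) \<in> pres_cong X R"
| trans: "(u, v) \<in> pres_cong X R \<Longrightarrow> (v, w) \<in> pres_cong X R \<Longrightarrow> (u, w) \<in> pres_cong X R"
| left: "(u, v) \<in> pres_cong X R \<Longrightarrow> w \<in> words X \<Longrightarrow> (w @ u, w @ v) \<in> pres_cong X R"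
| right: "(u, v) \<in> pres_cong X R \<Longrightarrow> w \<in> words X \<Longrightarrow> (u @ w, v @ w) \<in> pres_cong X R"

text \<open>The product of two classes is the class of the concatenation of representatives; see
  \<open>presented_mult\<close> below.\<close>

definition presented_sgrp :: "'x set \<Rightarrow> ('x list \<times> 'x list) set \<Rightarrow> 'x list set sgrp" where
  "presented_sgrp X R =
     \<lparr>carrier = words X // pres_cong X R,
      sgmult = (\<lambda>A B. pres_cong X R `` {u @ v | u v. u \<in> A \<and> v \<in> B})\<rparr>"

lemma words_append: "u \<in> words X \<Longrightarrow> v \<in> words X \<Longrightarrow> u @ v \<in> words X"
  by (auto simp: words_def)

lemma pres_cong_words:
  assumes "(u, v) \<in> pres_cong X R"
  shows "u \<in> words X \<and> v \<in> words X"
  using assms by induction (auto intro: words_append)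

lemma equiv_pres_cong: "equiv (words X) (pres_cong X R)"
proof (rule equivI)
  show "pres_cong X R \<subseteq> words X \<times> words X"
    using pres_cong_words by fast
  show "refl_on (words X) (pres_cong X R)"
    by (auto simp: refl_on_def intro: pres_cong.refl)
  show "sym (pres_cong X R)"
    by (auto intro: symI pres_cong.sym)
  show "trans (pres_cong X R)"
    by (rule transI) (rule pres_cong.trans)
qed

lemma pres_cong_append:
  assumes "(u, u') \<in> pres_cong X R" "(v, v') \<in> pres_cong X R"
  shows "(u @ v, u' @ v') \<in> pres_cong X R"
  using assms pres_cong_words[OF assms(1)] pres_cong_words[OF assms(2)]
  by (blast intro: pres_cong.trans pres_cong.left pres_cong.right)

lemma presented_mult:
  assumes "u \<in> words X" "v \<in> words X"
  shows "pres_cong X R `` {u} \<cdot>\<^bsub>presented_sgrp X R\<^esub> pres_cong X R `` {v} = pres_cong X R `` {u @ v}"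
  using assms
  by (auto simp: presented_sgrp_def
      intro: pres_cong.refl pres_cong.trans[OF pres_cong_append] )


section \<open>Networks\<close>

record ('v, 't) network_data =
  verts :: "'v set"
  rels :: "'t set"
  snd_of :: "'t \<Rightarrow> 'v set"
  rcv_of :: "'t \<Rightarrow> 'v set"

locale network =
  fixes \<Gamma> :: "('v, 't) network_data" (structure)
  assumes snd_subset: "t \<in> rels \<Gamma> \<Longrightarrow> snd_of \<Gamma> t \<subseteq> verts \<Gamma>"
    and rcv_subset: "t \<in> rels \<Gamma> \<Longrightarrow> rcv_of \<Gamma> t \<subseteq> verts \<Gamma>"
    and snd_nonempty: "t \<in> rels \<Gamma> \<Longrightarrow> snd_of \<Gamma> t \<noteq> {}"
    and rcv_nonempty: "t \<in> rels \<Gamma> \<Longrightarrow> rcv_of \<Gamma> t \<noteq> {}"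
    and snd_rcv_disjoint: "t \<in> rels \<Gamma> \<Longrightarrow> snd_of \<Gamma> t \<inter> rcv_of \<Gamma> t = {}"
    and countable_verts: "countable (verts \<Gamma>)"
    and countable_rels: "countable (rels \<Gamma>)"

text \<open>A vertex \<open>v\<close> is identified with the singleton \<open>{v}\<close>.\<close>

definition T0 :: "('v, 't) network_data \<Rightarrow> 'v set set" where
  "T0 \<Gamma> = snd_of \<Gamma> ` rels \<Gamma> \<union> rcv_of \<Gamma> ` rels \<Gamma> \<union> (\<lambda>v. {v}) ` verts \<Gamma>"

datatype ('v, 't) symb = Rel 't | Obj "'v set" | InvRel 't | Zero

text \<open>The maps \<open>\<^bold>s\<close> and \<open>\<^bold>r\<close> on \<open>T \<union> T\<^sup>0 \<union> T\<^sup>-\<^sup>1\<close>; they are not defined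
  at \<^const>\<open>Zero\<close>, and the value there is never used.\<close>

fun src :: "('v, 't) network_data \<Rightarrow> ('v, 't) symb \<Rightarrow> 'v set" where
  "src \<Gamma> (Rel t) = snd_of \<Gamma> t"
| "src \<Gamma> (Obj A) = A"
| "src \<Gamma> (InvRel t) = rcv_of \<Gamma> t"
| "src \<Gamma> Zero = {}"

fun rng :: "('v, 't) network_data \<Rightarrow> ('v, 't) symb \<Rightarrow> 'v set" where
  "rng \<Gamma> (Rel t) = rcv_of \<Gamma> t"
| "rng \<Gamma> (Obj A) = A"
| "rng \<Gamma> (InvRel t) = snd_of \<Gamma> t"
| "rng \<Gamma> Zero = {}"

definition nonzero_symbs :: "('v, 't) network_data \<Rightarrow> ('v, 't) symb set" where
  "nonzero_symbs \<Gamma> = Rel ` rels \<Gamma> \<union> Obj ` T0 \<Gamma> \<union> InvRel ` rels \<Gamma>"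

definition symbs :: "('v, 't) network_data \<Rightarrow> ('v, 't) symb set" where
  "symbs \<Gamma> = insert Zero (nonzero_symbs \<Gamma>)"

inductive_set Q_rels :: "('v, 't) network_data \<Rightarrow> (('v, 't) symb list \<times> ('v, 't) symb list) set"
  for \<Gamma> where
  NR1_src: "x \<in> nonzero_symbs \<Gamma> \<Longrightarrow> ([Obj (src \<Gamma> x), x], [x]) \<in> Q_rels \<Gamma>"
| NR1_rng: "x \<in> nonzero_symbs \<Gamma> \<Longrightarrow> ([x, Obj (rng \<Gamma> x)], [x]) \<in> Q_rels \<Gamma>"
| NR2: "x \<in> nonzero_symbs \<Gamma> \<Longrightarrow> y \<in> nonzero_symbs \<Gamma> \<Longrightarrow> rng \<Gamma> x \<inter> src \<Gamma> y = {} \<Longrightarrow>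
    ([x, y], [Zero]) \<in> Q_rels \<Gamma>"
| NR3: "t \<in> rels \<Gamma> \<Longrightarrow> u \<in> rels \<Gamma> \<Longrightarrow> t \<noteq> u \<Longrightarrow> ([InvRel t, Rel u], [Zero]) \<in> Q_rels \<Gamma>"
| NR4: "t \<in> rels \<Gamma> \<Longrightarrow> ([InvRel t, Rel t], [Obj (rcv_of \<Gamma> t)]) \<in> Q_rels \<Gamma>"
| NR5: "t \<in> rels \<Gamma> \<Longrightarrow> A \<in> T0 \<Gamma> \<Longrightarrow> snd_of \<Gamma> t \<noteq> A \<Longrightarrow>
    ([InvRel t, Obj A], [Zero]) \<in> Q_rels \<Gamma>"
| NR6_left: "x \<in> symbs \<Gamma> \<Longrightarrow> ([Zero, x], [Zero]) \<in> Q_rels \<Gamma>"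
| NR6_right: "x \<in> symbs \<Gamma> \<Longrightarrow> ([x, Zero], [Zero]) \<in> Q_rels \<Gamma>"

definition Q :: "('v, 't) network_data \<Rightarrow> ('v, 't) symb list set sgrp" where
  "Q \<Gamma> = presented_sgrp (symbs \<Gamma>) (Q_rels \<Gamma>)"

definition cls :: "('v, 't) network_data \<Rightarrow> ('v, 't) symb list \<Rightarrow> ('v, 't) symb list set" where
  "cls \<Gamma> w = pres_cong (symbs \<Gamma>) (Q_rels \<Gamma>) `` {w}"

text \<open>In particular the side conditions \<open>u \<in> words X\<close> and \<open>v \<in> words X\<close> in \<open>pres_cong.rel\<close>
  discard none of the relations.\<close>

lemma Q_rels_words: "Q_rels \<Gamma> \<subseteq> words (symbs \<Gamma>) \<times> words (symbs \<Gamma>)"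
proof -
  have "(u, v) \<in> Q_rels \<Gamma> \<Longrightarrow> u \<in> words (symbs \<Gamma>) \<and> v \<in> words (symbs \<Gamma>)" for u v
    by (induction rule: Q_rels.induct)
      (auto simp: words_def symbs_def nonzero_symbs_def T0_def)
  then show ?thesis by auto
qed

definition RLP :: "('v, 't) network_data \<Rightarrow> ('v, 't) symb list set" where
  "RLP \<Gamma> = {\<alpha>. \<alpha> \<noteq> [] \<and> set \<alpha> \<subseteq> Rel ` rels \<Gamma> \<union> Obj ` T0 \<Gamma> \<and>
     (\<forall>i. Suc i < length \<alpha> \<longrightarrow>
        rng \<Gamma> (\<alpha> ! i) = src \<Gamma> (\<alpha> ! Suc i) \<and>
        \<alpha> ! i \<noteq> Obj (src \<Gamma> (\<alpha> ! Suc i)) \<and>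
        \<alpha> ! Suc i \<noteq> Obj (rng \<Gamma> (\<alpha> ! i)))}"

fun symb_inv :: "('v, 't) symb \<Rightarrow> ('v, 't) symb" where
  "symb_inv (Rel t) = InvRel t"
| "symb_inv (Obj A) = Obj A"
| "symb_inv (InvRel t) = Rel t"
| "symb_inv Zero = Zero"

definition path_inv :: "('v, 't) symb list \<Rightarrow> ('v, 't) symb list" where
  "path_inv \<alpha> = rev (map symb_inv \<alpha>)"

text \<open>\<open>T\<^sup>0\<close> and \<open>T\<close> as sets of paths of length one.\<close>

definition T0_paths :: "('v, 't) network_data \<Rightarrow> ('v, 't) symb list set" where
  "T0_paths \<Gamma> = (\<lambda>A. [Obj A]) ` T0 \<Gamma>"

definition T_paths :: "('v, 't) network_data \<Rightarrow> ('v, 't) symb list set" where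
  "T_paths \<Gamma> = (\<lambda>t. [Rel t]) ` rels \<Gamma>"

end

theory Submission
  imports Defs
begin

text \<open>
  The proof rests on a solution of the word problem of \<open>Q\<^sub>\<Gamma>\<close>. Besides \<open>0\<close>, every element has a
  unique reduced word \<open>p q\<^sup>-\<^sup>1\<close>: \<open>p\<close> is a word over \<open>T \<union> T\<^sup>0\<close> whose neighbours meet, \<open>q\<^sup>-\<^sup>1\<close>
  is a word over \<open>T\<^sup>-\<^sup>1\<close> whose neighbours match exactly, and no object stands next to a letter
  that absorbs it by (NR1). The asymmetry comes from (NR5), which gives
  \<open>t\<^sup>-\<^sup>1 x = t\<^sup>-\<^sup>1 \<^bold>s(x) x = 0\<close> whenever \<open>\<^bold>s(x) \<noteq> \<^bold>s(t)\<close>, while nothing similar holds for \<open>x t\<close>.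
  Uniqueness is obtained by letting the letters act on reduced words (\<open>lmult\<close>): the
  action satisfies the defining relations (\<open>lmult_Q_rels\<close>), and it only rewrites words inside
  their class (\<open>eqv_lmult\<close>). Hence equality in \<open>Q\<^sub>\<Gamma>\<close> is equality of normal forms
  (\<open>cls_eq_iff\<close>).

  If \<open>e \<le> f\<close> and \<open>f\<close> is idempotent, then \<open>e f = e\<close>, so maximality of \<open>e\<close> is a question about the
  right stabiliser of \<open>e\<close>. If \<open>A w = A\<close>, then comparing normal forms forces \<open>w = A\<close>
  (\<open>lmult_Obj_eq_Obj\<close>); so \<open>A\<close> is maximal. If \<open>t t\<^sup>-\<^sup>1 w = t t\<^sup>-\<^sup>1\<close>, then \<open>w = \<^bold>s(t)\<close> or
  \<open>w = t t\<^sup>-\<^sup>1\<close> (\<open>lmult_Rel_InvRel_eq\<close>); so \<open>t t\<^sup>-\<^sup>1\<close> is maximal once the objects are removed.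
  Conversely, a path \<open>\<alpha>\<close> that starts with \<open>t \<in> T\<close> has \<open>\<alpha> \<alpha>\<^sup>-\<^sup>1 \<le> t t\<^sup>-\<^sup>1 \<le> \<^bold>s(t)\<close>; the second
  inequality is always strict, and the first one is strict when \<open>\<alpha>\<close> has a second letter, again by
  comparison of normal forms.
\<close>

section \<open>Reduced words and the action of the letters\<close>

text \<open>
  The last conjunct says that an inverse letter is followed only by inverse letters, and
  \<open>t\<^sup>-\<^sup>1 u\<^sup>-\<^sup>1\<close> requires the equality \<open>\<^bold>r(u) = \<^bold>s(t)\<close> rather than just an intersection.
\<close>

definition reduced_pair :: "('v, 't) network_data \<Rightarrow> ('v, 't) symb \<Rightarrow> ('v, 't) symb \<Rightarrow> bool" where
  "reduced_pair \<Gamma> x y \<longleftrightarrow> rng \<Gamma> x \<inter> src \<Gamma> y \<noteq> {} \<and> x \<noteq> Obj (src \<Gamma> y) \<and> y \<noteq> Obj (rng \<Gamma> x) \<and>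
     (\<forall>t. x = InvRel t \<longrightarrow> (\<exists>u. y = InvRel u \<and> rcv_of \<Gamma> u = snd_of \<Gamma> t))"

text \<open>
  The empty word counts as reduced: it represents no element of \<open>Q\<^sub>\<Gamma>\<close>, but it is the starting
  point from which the action of the letters builds every normal form.
\<close>

definition reduced :: "('v, 't) network_data \<Rightarrow> ('v, 't) symb list \<Rightarrow> bool" where
  "reduced \<Gamma> n \<longleftrightarrow>
     n = [Zero] \<or> set n \<subseteq> nonzero_symbs \<Gamma> \<and> successively (reduced_pair \<Gamma>) n"

text \<open>
  The normal form of \<open>x m\<close> for a letter \<open>x\<close> and a reduced word \<open>m\<close>. Since \<open>src \<Gamma> Zero\<close> is empty,
  the tests for disjointness also send \<open>m = [Zero]\<close> to \<open>[Zero]\<close>. In the clause for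
  \<open>t\<^sup>-\<^sup>1 A n\<close> the result is \<open>0\<close> for non-empty \<open>n\<close>, even if \<open>A = \<^bold>s(t)\<close>: as \<open>A n\<close> is reduced, the
  next letter \<open>z\<close> has \<open>\<^bold>s(z) \<noteq> A\<close>, so that \<open>t\<^sup>-\<^sup>1 A z = t\<^sup>-\<^sup>1 \<^bold>s(z) z = 0\<close>.
\<close>

fun lmult :: "('v, 't) network_data \<Rightarrow> ('v, 't) symb \<Rightarrow> ('v, 't) symb list \<Rightarrow> ('v, 't) symb list" where
  "lmult \<Gamma> x [] = [x]"
| "lmult \<Gamma> (Obj A) (y # n) =
     (if A \<inter> src \<Gamma> y = {} then [Zero] else if src \<Gamma> y = A then y # n else Obj A # y # n)"
| "lmult \<Gamma> (Rel t) (y # n) =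
     (if rcv_of \<Gamma> t \<inter> src \<Gamma> y = {} then [Zero]
      else if y = Obj (rcv_of \<Gamma> t) then Rel t # n else Rel t # y # n)"
| "lmult \<Gamma> (InvRel t) (Rel u # n) = (if t = u then lmult \<Gamma> (Obj (rcv_of \<Gamma> t)) n else [Zero])"
| "lmult \<Gamma> (InvRel t) (Obj A # n) = (if A = snd_of \<Gamma> t \<and> n = [] then [InvRel t] else [Zero])"
| "lmult \<Gamma> (InvRel t) (InvRel u # n) =
     (if rcv_of \<Gamma> u = snd_of \<Gamma> t then InvRel t # InvRel u # n else [Zero])"
| "lmult \<Gamma> (InvRel t) (Zero # n) = [Zero]"
| "lmult \<Gamma> Zero (y # n) = [Zero]"

definition nf :: "('v, 't) network_data \<Rightarrow> ('v, 't) symb list \<Rightarrow> ('v, 't) symb list" where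
  "nf \<Gamma> w = foldr (lmult \<Gamma>) w []"

lemma nonzero_symbs_simps [simp]:
  "Rel t \<in> nonzero_symbs \<Gamma> \<longleftrightarrow> t \<in> rels \<Gamma>"
  "InvRel t \<in> nonzero_symbs \<Gamma> \<longleftrightarrow> t \<in> rels \<Gamma>"
  "Obj A \<in> nonzero_symbs \<Gamma> \<longleftrightarrow> A \<in> T0 \<Gamma>"
  "Zero \<notin> nonzero_symbs \<Gamma>"
  by (auto simp: nonzero_symbs_def)

lemma symbs_simps [simp]:
  "x \<in> symbs \<Gamma> \<longleftrightarrow> x = Zero \<or> x \<in> nonzero_symbs \<Gamma>"
  by (auto simp: symbs_def)

lemma nonzero_subset_symbs: "A \<subseteq> nonzero_symbs \<Gamma> \<Longrightarrow> A \<subseteq> symbs \<Gamma>"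
  by auto

lemma T0_simps [simp]:
  "t \<in> rels \<Gamma> \<Longrightarrow> snd_of \<Gamma> t \<in> T0 \<Gamma>"
  "t \<in> rels \<Gamma> \<Longrightarrow> rcv_of \<Gamma> t \<in> T0 \<Gamma>"
  by (auto simp: T0_def)

lemma lmult_Zero: "lmult \<Gamma> x [Zero] = [Zero]"
  by (cases x) auto

lemma lmult_Zero_left: "lmult \<Gamma> Zero n = [Zero]"
  by (cases n) auto

lemma lmult_ne: "lmult \<Gamma> x n \<noteq> []"
  by (induction \<Gamma> x n rule: lmult.induct) auto

lemma lmult_Rel: "lmult \<Gamma> (Rel t) n = [Zero] \<or> (\<exists>m. lmult \<Gamma> (Rel t) n = Rel t # m)"
  by (cases n) auto

lemma reduced_Nil [simp]: "reduced \<Gamma> []"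
  by (simp add: reduced_def)

lemma nf_Cons: "nf \<Gamma> (x # w) = lmult \<Gamma> x (nf \<Gamma> w)"
  by (simp add: nf_def)

context network
begin

lemma T0_nonempty: "A \<in> T0 \<Gamma> \<Longrightarrow> A \<noteq> {}"
  using snd_nonempty rcv_nonempty by (auto simp: T0_def)

lemma src_rng_T0:
  assumes "x \<in> nonzero_symbs \<Gamma>"
  shows "src \<Gamma> x \<in> T0 \<Gamma>" "rng \<Gamma> x \<in> T0 \<Gamma>"
  using assms by (cases x; auto)+

lemma reduced_lmult:
  assumes "reduced \<Gamma> n" "x \<in> symbs \<Gamma>"
  shows "reduced \<Gamma> (lmult \<Gamma> x n)"
  using assms snd_nonempty
  by (induction \<Gamma> x n rule: lmult.induct)
     (auto simp: reduced_def reduced_pair_def successively_Cons split: if_splits)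

lemma reduced_foldr:
  assumes "w \<in> lists (symbs \<Gamma>)" "reduced \<Gamma> n"
  shows "reduced \<Gamma> (foldr (lmult \<Gamma>) w n)"
  using assms by (induction w) (auto intro: reduced_lmult simp del: symbs_simps)

lemma src_hd_lmult:
  assumes "reduced \<Gamma> n" "x \<in> nonzero_symbs \<Gamma>"
  shows "lmult \<Gamma> x n = [Zero] \<or> (\<exists>y m. lmult \<Gamma> x n = y # m \<and> src \<Gamma> y = src \<Gamma> x)"
  using assms
  by (induction \<Gamma> x n rule: lmult.induct) (auto simp: reduced_def successively_Cons)

text \<open>
  On normal forms, this is the consequence of (NR1) and (NR5) that makes the left factor
  \<open>t\<^sup>-\<^sup>1\<close> so restrictive; it covers objects, relations and inverses at once.
\<close>

lemma lmult_InvRel_mismatch: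
  "src \<Gamma> y \<noteq> snd_of \<Gamma> t \<Longrightarrow> lmult \<Gamma> (InvRel t) (y # n) = [Zero]"
  by (cases y) auto

lemma lmult_disjoint:
  assumes "x \<in> nonzero_symbs \<Gamma>" "rng \<Gamma> x \<inter> src \<Gamma> y = {}"
  shows "lmult \<Gamma> x (y # n) = [Zero]"
  using assms snd_nonempty by (cases x) (auto intro!: lmult_InvRel_mismatch)

text \<open>
  The heart of uniqueness: both sides of each defining relation act in the same way. This takes
  the place of checking the critical pairs of a rewriting system.
\<close>

lemma lmult_Q_rels:
  assumes "(u, v) \<in> Q_rels \<Gamma>" "reduced \<Gamma> n"
  shows "foldr (lmult \<Gamma>) u n = foldr (lmult \<Gamma>) v n"
  using assms(1)
proof cases
  case (NR1_src x)
  then show ?thesis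
    using src_hd_lmult[OF assms(2) NR1_src(3)] T0_nonempty[OF src_rng_T0(1)[OF NR1_src(3)]]
    by (auto simp: lmult_Zero split: if_splits)
next
  case (NR1_rng x)
  show ?thesis
  proof (cases n)
    case Nil
    then show ?thesis using NR1_rng T0_nonempty[OF src_rng_T0(2)[OF NR1_rng(3)]]
      by (cases x) auto
  next
    case (Cons y m)
    then have "y \<in> nonzero_symbs \<Gamma> \<or> y = Zero"
      using assms(2) by (auto simp: reduced_def)
    then show ?thesis
      using Cons NR1_rng assms(2) snd_nonempty rcv_nonempty
      by (cases x)
       (auto simp: reduced_def reduced_pair_def successively_Cons lmult_InvRel_mismatch)
  qed
next
  case (NR2 x y)
  then show ?thesis
    using src_hd_lmult[OF assms(2) NR2(4)] lmult_disjoint[OF NR2(3)]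
    by (auto simp: lmult_Zero lmult_Zero_left)
next
  case (NR3 t u)
  then show ?thesis using lmult_Rel[of \<Gamma> u n]
    by (auto simp: lmult_Zero_left)
next
  case (NR4 t)
  then show ?thesis using assms(2) rcv_nonempty[of t]
    by (cases n; cases "tl n")
       (auto simp: reduced_def reduced_pair_def successively_Cons split: if_splits)
next
  case (NR5 t A)
  then have "lmult \<Gamma> (InvRel t) (lmult \<Gamma> (Obj A) n) = [Zero]"
    using src_hd_lmult[OF assms(2), of "Obj A"] by (metis lmult_InvRel_mismatch lmult_Zero
      nonzero_symbs_simps(3) src.simps(2))
  with NR5 show ?thesis by (simp add: lmult_Zero_left)
qed (simp_all add: lmult_Zero_left lmult_Zero)

text \<open>
  The induction needs an arbitrary reduced \<open>n\<close>: for the closure under right multiplication by \<open>w\<close>,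
  the hypothesis is used at the reduced word to which \<open>w\<close> sends \<open>n\<close>.
\<close>

lemma lmult_cong:
  assumes "(u, v) \<in> pres_cong (symbs \<Gamma>) (Q_rels \<Gamma>)" "reduced \<Gamma> n"
  shows "foldr (lmult \<Gamma>) u n = foldr (lmult \<Gamma>) v n"
  using assms
proof (induction arbitrary: n)
  case (rel u v)
  then show ?case by (intro lmult_Q_rels)
next
  case (right u v w)
  then show ?case by (auto simp: words_def intro!: reduced_foldr right.IH simp del: symbs_simps)
qed auto

section \<open>Every word is equivalent to its normal form\<close>

abbreviation eqv :: "('v, 't) symb list \<Rightarrow> ('v, 't) symb list \<Rightarrow> bool" (infix "\<approx>" 50) where
  "u \<approx> v \<equiv> (u, v) \<in> pres_cong (symbs \<Gamma>) (Q_rels \<Gamma>)"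

lemma eqv_rel: "(u, v) \<in> Q_rels \<Gamma> \<Longrightarrow> u \<approx> v"
  using Q_rels_words by (auto intro: pres_cong.rel)

lemma eqv_context:
  assumes "u \<approx> v" "set p \<subseteq> symbs \<Gamma>" "set q \<subseteq> symbs \<Gamma>"
  shows "p @ u @ q \<approx> p @ v @ q"
proof -
  have "u @ q \<approx> v @ q"
    using assms by (cases "q = []") (auto intro!: pres_cong.right simp: words_def)
  then show ?thesis
    using assms by (cases "p = []") (auto intro!: pres_cong.left simp: words_def)
qed

lemma eqv_rel_left:
  assumes "(u, v) \<in> Q_rels \<Gamma>" "set q \<subseteq> symbs \<Gamma>"
  shows "u @ q \<approx> v @ q"
  using eqv_context[OF eqv_rel[OF assms(1)], of "[]"] assms(2) by simp

lemma Zero_absorb_right: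
  assumes "set w \<subseteq> symbs \<Gamma>"
  shows "Zero # w \<approx> [Zero]"
  using assms
proof (induction w)
  case Nil
  show ?case by (rule pres_cong.refl) (auto simp: words_def)
next
  case (Cons x w)
  then have "[Zero, x] @ w \<approx> [Zero] @ w"
    by (intro eqv_rel_left NR6_left) auto
  with Cons show ?case by (auto intro: pres_cong.trans)
qed

lemma eqv_Zero:
  assumes "([x, y], [Zero]) \<in> Q_rels \<Gamma>" "set m \<subseteq> symbs \<Gamma>"
  shows "x # y # m \<approx> [Zero]"
  using pres_cong.trans[OF eqv_rel_left[OF assms]] Zero_absorb_right[OF assms(2)] by simp

lemma eqv_refl: "x \<in> symbs \<Gamma> \<Longrightarrow> set n \<subseteq> symbs \<Gamma> \<Longrightarrow> x # n \<approx> x # n"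
  by (rule pres_cong.refl) (auto simp: words_def)

lemma reduced_symbs: "reduced \<Gamma> n \<Longrightarrow> set n \<subseteq> symbs \<Gamma>"
  by (auto simp: reduced_def)

lemma eqv_lmult_Obj:
  assumes "reduced \<Gamma> n" "A \<in> T0 \<Gamma>"
  shows "Obj A # n \<approx> lmult \<Gamma> (Obj A) n"
proof (cases "n = [] \<or> n = [Zero]")
  case True
  then show ?thesis using assms by (auto intro!: eqv_refl eqv_Zero NR6_right)
next
  case False
  then obtain y m where n: "n = y # m" and y: "y \<in> nonzero_symbs \<Gamma>" and m: "set m \<subseteq> symbs \<Gamma>"
    using assms(1) nonzero_subset_symbs by (cases n) (auto simp: reduced_def)
  show ?thesis
    using eqv_rel_left[OF NR1_src[OF y] m] y assms m
    by (auto simp: n intro!: eqv_refl eqv_Zero NR2)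
qed

text \<open>The letter \<open>z\<close> absorbs \<open>\<^bold>s(z)\<close> on its left, and \<open>t\<^sup>-\<^sup>1 \<^bold>s(z) = 0\<close> by (NR5).\<close>

lemma eqv_InvRel_mismatch:
  assumes "t \<in> rels \<Gamma>" "z \<in> nonzero_symbs \<Gamma>" "src \<Gamma> z \<noteq> snd_of \<Gamma> t" "set m \<subseteq> symbs \<Gamma>"
  shows "InvRel t # z # m \<approx> [Zero]"
proof -
  have A: "src \<Gamma> z \<in> T0 \<Gamma>" using assms(2) by (rule src_rng_T0)
  have "[InvRel t] @ [z] @ m \<approx> [InvRel t] @ [Obj (src \<Gamma> z), z] @ m"
    using assms by (intro eqv_context pres_cong.sym[OF eqv_rel[OF NR1_src]]) auto
  moreover have "[InvRel t, Obj (src \<Gamma> z)] @ (z # m) \<approx> [Zero] @ (z # m)"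
    using assms A by (intro eqv_rel_left NR5) auto
  moreover have "Zero # z # m \<approx> [Zero]"
    using assms by (intro Zero_absorb_right) auto
  ultimately show ?thesis by (auto intro: pres_cong.trans)
qed

text \<open>
  Objects are treated separately in \<open>eqv_lmult_Obj\<close>, because \<open>t\<^sup>-\<^sup>1 t\<close> becomes the object \<open>\<^bold>r(t)\<close>,
  which then has to be multiplied with the rest of the word.
\<close>

lemma eqv_lmult:
  assumes "reduced \<Gamma> n" "x \<in> symbs \<Gamma>"
  shows "x # n \<approx> lmult \<Gamma> x n"
proof (cases "n = [] \<or> n = [Zero] \<or> x = Zero")
  case True
  then show ?thesis using assms reduced_symbs[OF assms(1)]
    by (auto intro!: eqv_refl eqv_Zero NR6_right Zero_absorb_right simp: lmult_Zero lmult_Zero_left)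
next
  case False
  then obtain y m where n: "n = y # m" and y: "y \<in> nonzero_symbs \<Gamma>" and m: "set m \<subseteq> symbs \<Gamma>"
    and x: "x \<in> nonzero_symbs \<Gamma>"
    using assms nonzero_subset_symbs by (cases n) (auto simp: reduced_def)
  have red: "reduced \<Gamma> m" using assms(1) by (auto simp: n reduced_def successively_Cons)
  show ?thesis
  proof (cases x)
    case (Obj A)
    with x assms(1) show ?thesis by (auto intro: eqv_lmult_Obj)
  next
    case (Rel t)
    then show ?thesis
      using eqv_rel_left[OF NR1_rng[OF x] m] y x m
      by (auto simp: n intro!: eqv_refl eqv_Zero NR2)
  next
    case (InvRel t)
    show ?thesis
    proof (cases y)
      case (Rel u)
      show ?thesis
      proof (cases "t = u")
        case True
        then have "InvRel t # Rel t # m \<approx> Obj (rcv_of \<Gamma> t) # m"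
          using eqv_rel_left[OF NR4 m, of t] x InvRel by simp
        then show ?thesis
          using eqv_lmult_Obj[OF red, of "rcv_of \<Gamma> t"] InvRel x True
          by (auto simp: n Rel intro: pres_cong.trans)
      next
        case False
        then show ?thesis using InvRel Rel x y m by (auto simp: n intro!: eqv_Zero NR3)
      qed
    next
      case (Obj A)
      show ?thesis
      proof (cases "A = snd_of \<Gamma> t")
        case True
        have 1: "InvRel t # y # m \<approx> InvRel t # m"
          using eqv_rel_left[OF NR1_rng[OF x] m] InvRel Obj True by simp
        show ?thesis
        proof (cases m)
          case Nil
          then show ?thesis using 1 InvRel Obj True by (simp add: n)
        next
          case (Cons z k)
          with assms(1) y have "z \<in> nonzero_symbs \<Gamma>" "src \<Gamma> z \<noteq> snd_of \<Gamma> t" "set k \<subseteq> symbs \<Gamma>"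
            using Obj True by (auto simp: n reduced_def successively_Cons reduced_pair_def)
          then show ?thesis
            using eqv_InvRel_mismatch[of t z k] 1 x InvRel Obj Cons
            by (auto simp: n intro: pres_cong.trans)
        qed
      next
        case False
        then show ?thesis using InvRel Obj x y m by (auto simp: n intro!: eqv_Zero NR5)
      qed
    next
      case (InvRel u)
      show ?thesis
      proof (cases "rcv_of \<Gamma> u = snd_of \<Gamma> t")
        case True
        then show ?thesis
          using eqv_refl[OF assms(2) reduced_symbs[OF assms(1)]] \<open>x = InvRel t\<close> InvRel
          by (simp add: n)
      next
        case False
        then show ?thesis using \<open>x = InvRel t\<close> InvRel x y m
          by (auto simp: n intro!: eqv_InvRel_mismatch)
      qed
    next
      case Zero
      with y show ?thesis by simp
    qed
  next
    case Zero
    with x show ?thesis by simp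
  qed
qed

lemma eqv_nf:
  assumes "w \<in> words (symbs \<Gamma>)"
  shows "w \<approx> nf \<Gamma> w"
proof -
  have "x # w \<approx> nf \<Gamma> (x # w)" if "set (x # w) \<subseteq> symbs \<Gamma>" for x w
    using that
  proof (induction w arbitrary: x)
    case Nil
    then show ?case by (auto simp: nf_def intro!: eqv_refl)
  next
    case (Cons y w)
    have "[x] @ (y # w) @ [] \<approx> [x] @ nf \<Gamma> (y # w) @ []"
      using Cons by (intro eqv_context) auto
    moreover have "x # nf \<Gamma> (y # w) \<approx> nf \<Gamma> (x # y # w)"
      using Cons.prems unfolding nf_Cons[of _ x]
      by (intro eqv_lmult) (auto simp: nf_def simp del: foldr.simps intro!: reduced_foldr)
    ultimately show ?case by (auto intro: pres_cong.trans)
  qed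
  then show ?thesis using assms by (cases w) (auto simp: words_def)
qed


text \<open>
  Soundness of the action applied to the empty word makes \<open>nf\<close> constant on classes; conversely,
  words with the same normal form are linked by it.
\<close>

lemma cls_eq_iff:
  assumes "u \<in> words (symbs \<Gamma>)" "v \<in> words (symbs \<Gamma>)"
  shows "cls \<Gamma> u = cls \<Gamma> v \<longleftrightarrow> nf \<Gamma> u = nf \<Gamma> v"
proof -
  have "cls \<Gamma> u = cls \<Gamma> v \<longleftrightarrow> u \<approx> v"
    unfolding cls_def using assms by (rule eq_equiv_class_iff[OF equiv_pres_cong])
  moreover have "nf \<Gamma> u = nf \<Gamma> v" if "u \<approx> v"
    unfolding nf_def using that by (rule lmult_cong) simp
  moreover have "u \<approx> v" if "nf \<Gamma> u = nf \<Gamma> v"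
    using eqv_nf[OF assms(1)] eqv_nf[OF assms(2)] that
    by (metis pres_cong.sym pres_cong.trans)
  ultimately show ?thesis by blast
qed

lemma reduced_nf: "w \<in> words (symbs \<Gamma>) \<Longrightarrow> reduced \<Gamma> (nf \<Gamma> w)"
  unfolding nf_def by (rule reduced_foldr) (auto simp: words_def)

lemma nf_nonempty: "w \<in> words (symbs \<Gamma>) \<Longrightarrow> nf \<Gamma> w \<noteq> []"
  by (cases w) (auto simp: words_def nf_Cons lmult_ne)

section \<open>The natural partial order on idempotents\<close>

lemma cls_mult:
  assumes "u \<in> words (symbs \<Gamma>)" "v \<in> words (symbs \<Gamma>)"
  shows "cls \<Gamma> u \<cdot>\<^bsub>Q \<Gamma>\<^esub> cls \<Gamma> v = cls \<Gamma> (u @ v)"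
  unfolding cls_def Q_def using assms by (rule presented_mult)

lemma carrier_Q: "carrier (Q \<Gamma>) = cls \<Gamma> ` words (symbs \<Gamma>)"
  by (auto simp: Q_def presented_sgrp_def quotient_def cls_def)

lemma Q_assoc:
  assumes "a \<in> carrier (Q \<Gamma>)" "b \<in> carrier (Q \<Gamma>)" "c \<in> carrier (Q \<Gamma>)"
  shows "a \<cdot>\<^bsub>Q \<Gamma>\<^esub> b \<cdot>\<^bsub>Q \<Gamma>\<^esub> c = a \<cdot>\<^bsub>Q \<Gamma>\<^esub> (b \<cdot>\<^bsub>Q \<Gamma>\<^esub> c)"
  using assms by (auto simp: carrier_Q cls_mult words_append)

lemma cls_eqI: "u \<approx> v \<Longrightarrow> cls \<Gamma> u = cls \<Gamma> v"
  unfolding cls_def by (rule equiv_class_eq[OF equiv_pres_cong])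

text \<open>If \<open>e = x f\<close>, then \<open>e f = x f f = x f = e\<close>.\<close>

lemma nat_le_absorb:
  assumes "nat_le (Q \<Gamma>) e f" "f \<in> idempotents (Q \<Gamma>)"
  shows "e \<cdot>\<^bsub>Q \<Gamma>\<^esub> f = e"
proof -
  obtain x where x: "x \<in> carrier (adjoin_one (Q \<Gamma>))" "Some e = x \<cdot>\<^bsub>adjoin_one (Q \<Gamma>)\<^esub> Some f"
    using assms(1) by (auto simp: nat_le_def)
  have f: "f \<in> carrier (Q \<Gamma>)" "f \<cdot>\<^bsub>Q \<Gamma>\<^esub> f = f"
    using assms(2) by (auto simp: idempotents_def)
  show ?thesis
  proof (cases x)
    case None
    then show ?thesis using x f by (simp add: adjoin_one_def)
  next
    case (Some a)
    then have "a \<in> carrier (Q \<Gamma>)" "e = a \<cdot>\<^bsub>Q \<Gamma>\<^esub> f"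
      using x by (auto simp: adjoin_one_def split: if_splits)
    then show ?thesis using f by (simp add: Q_assoc)
  qed
qed

lemma nat_leI:
  assumes "e \<in> carrier S" "f \<in> carrier S" "e \<cdot>\<^bsub>S\<^esub> e = e" "e \<cdot>\<^bsub>S\<^esub> f = e" "f \<cdot>\<^bsub>S\<^esub> e = e"
  shows "nat_le S e f"
proof -
  have "Some e \<in> carrier (adjoin_one S)"
    using assms(1) by (simp add: adjoin_one_def)
  then show ?thesis
    unfolding nat_le_def using assms
    by (intro conjI bexI[of _ "Some e"]) (auto simp: adjoin_one_def)
qed

lemma eqv_nat_leI:
  assumes "u \<in> words (symbs \<Gamma>)" "v \<in> words (symbs \<Gamma>)" "u @ u \<approx> u" "u @ v \<approx> u" "v @ u \<approx> u"
  shows "nat_le (Q \<Gamma>) (cls \<Gamma> u) (cls \<Gamma> v)"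
  using assms by (intro nat_leI) (auto simp: carrier_Q cls_mult intro!: cls_eqI)

lemma idempotentI:
  assumes "u \<in> words (symbs \<Gamma>)" "u @ u \<approx> u"
  shows "cls \<Gamma> u \<in> idempotents (Q \<Gamma>)"
  using assms by (auto simp: idempotents_def carrier_Q cls_mult cls_eqI)

section \<open>Right stabilisers of objects and of short paths\<close>

lemma lmult_Obj_eq_Obj:
  assumes "lmult \<Gamma> (Obj A) n = [Obj A]" "n \<noteq> []"
  shows "n = [Obj A]"
  using assms by (cases n) (auto split: if_splits)

lemma lmult_Obj_eq_InvRel:
  assumes "lmult \<Gamma> (Obj A) n = [InvRel t]"
  shows "n = [InvRel t]"
  using assms by (cases n) (auto split: if_splits)

text \<open>
  A reduced word that becomes \<open>t t\<^sup>-\<^sup>1\<close> after multiplication by \<open>t\<close> must be \<open>t\<^sup>-\<^sup>1\<close>, as the only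
  other candidate \<open>\<^bold>r(t) t\<^sup>-\<^sup>1\<close> is not reduced. This in turn arises as \<open>t\<^sup>-\<^sup>1 n\<close> in two ways: either
  \<open>n = \<^bold>s(t)\<close>, or \<open>n = t m\<close> where \<open>\<^bold>r(t) m\<close> has normal form \<open>t\<^sup>-\<^sup>1\<close>.
\<close>

lemma lmult_Rel_InvRel_eq:
  assumes "lmult \<Gamma> (Rel t) (lmult \<Gamma> (InvRel t) n) = [Rel t, InvRel t]" "reduced \<Gamma> n" "n \<noteq> []"
    "t \<in> rels \<Gamma>"
  shows "n = [Obj (snd_of \<Gamma> t)] \<or> n = [Rel t, InvRel t]"
proof -
  let ?m = "lmult \<Gamma> (InvRel t) n"
  have "reduced \<Gamma> ?m"
    using assms by (intro reduced_lmult) auto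
  with assms(1) have m: "?m = [InvRel t]"
    by (cases ?m) (auto simp: reduced_def reduced_pair_def split: if_splits)
  obtain y k where n: "n = y # k" using assms(3) by (cases n) auto
  show ?thesis
    using m unfolding n
    by (cases y) (auto split: if_splits dest: lmult_Obj_eq_InvRel)
qed

section \<open>Paths and their idempotents\<close>

text \<open>
  In contrast to \<open>RLP \<Gamma>\<close>, linearity is stated without indices, so that the tail of a path with at
  least two letters is visibly a path again; \<open>path_inverse\<close> is an induction along such tails.
\<close>

definition linear_path :: "('v, 't) symb list \<Rightarrow> bool" where
  "linear_path \<alpha> \<longleftrightarrow> \<alpha> \<noteq> [] \<and> set \<alpha> \<subseteq> Rel ` rels \<Gamma> \<union> Obj ` T0 \<Gamma> \<and>
     successively (\<lambda>x y. rng \<Gamma> x = src \<Gamma> y) \<alpha>"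

lemma RLP_linear: "\<alpha> \<in> RLP \<Gamma> \<Longrightarrow> linear_path \<alpha>"
  by (auto simp: RLP_def linear_path_def successively_conv_nth)

lemma path_inv_symbs: "set \<alpha> \<subseteq> nonzero_symbs \<Gamma> \<Longrightarrow> set (path_inv \<alpha>) \<subseteq> symbs \<Gamma>"
proof -
  have "symb_inv x \<in> symbs \<Gamma>" if "x \<in> nonzero_symbs \<Gamma>" for x :: "('v, 't) symb"
    using that by (cases x) auto
  then show "set \<alpha> \<subseteq> nonzero_symbs \<Gamma> \<Longrightarrow> set (path_inv \<alpha>) \<subseteq> symbs \<Gamma>"
    by (auto simp: path_inv_def simp del: symbs_simps)
qed

lemma linear_path_nonzero: "linear_path \<alpha> \<Longrightarrow> set \<alpha> \<subseteq> nonzero_symbs \<Gamma>"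
  by (auto simp: linear_path_def)

text \<open>
  The inner factor \<open>x\<^sup>-\<^sup>1 x\<close> collapses to \<open>\<^bold>r(x)\<close>, which equals the source of the next letter by
  linearity and is absorbed there.
\<close>

lemma path_inverse:
  assumes "linear_path \<alpha>"
  shows "\<alpha> @ path_inv \<alpha> @ \<alpha> \<approx> \<alpha>"
  using assms
proof (induction \<alpha>)
  case Nil
  then show ?case by (simp add: linear_path_def)
next
  case (Cons x \<beta>)
  have x: "x \<in> nonzero_symbs \<Gamma>" and \<beta>0: "set \<beta> \<subseteq> nonzero_symbs \<Gamma>"
    using linear_path_nonzero[OF Cons.prems] by auto
  then have \<beta>: "set \<beta> \<subseteq> symbs \<Gamma>" "set (path_inv \<beta>) \<subseteq> symbs \<Gamma>"
    using path_inv_symbs by auto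
  have "[symb_inv x, x] \<approx> [Obj (rng \<Gamma> x)]"
    using Cons.prems by (auto simp: linear_path_def intro!: eqv_rel NR4 NR1_src[of "Obj _", simplified])
  then have 1: "(x # \<beta> @ path_inv \<beta>) @ [symb_inv x, x] @ \<beta> \<approx> (x # \<beta> @ path_inv \<beta>) @ [Obj (rng \<Gamma> x)] @ \<beta>"
    using x \<beta> by (intro eqv_context) auto
  show ?case
  proof (cases \<beta>)
    case Nil
    with 1 eqv_rel[OF NR1_rng[OF x]] show ?thesis
      by (auto simp: path_inv_def intro: pres_cong.trans)
  next
    case (Cons y \<gamma>)
    with Cons.prems have lin: "linear_path \<beta>" and xy: "rng \<Gamma> x = src \<Gamma> y"
      by (auto simp: linear_path_def)
    have y: "y \<in> nonzero_symbs \<Gamma>" using \<beta>0 Cons by auto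
    have "(x # \<beta> @ path_inv \<beta>) @ [Obj (src \<Gamma> y), y] @ \<gamma> \<approx> (x # \<beta> @ path_inv \<beta>) @ [y] @ \<gamma>"
      using x \<beta> y Cons by (intro eqv_context eqv_rel NR1_src) auto
    moreover have "[x] @ (\<beta> @ path_inv \<beta> @ \<beta>) @ [] \<approx> [x] @ \<beta> @ []"
      using x by (intro eqv_context Cons.IH lin) auto
    ultimately show ?thesis using 1 xy Cons
      by (auto simp: path_inv_def intro: pres_cong.trans)
  qed
qed

lemma path_words:
  assumes "linear_path \<alpha>"
  shows "\<alpha> @ path_inv \<alpha> \<in> words (symbs \<Gamma>)"
  using linear_path_nonzero[OF assms] path_inv_symbs[of \<alpha>] assms
  by (auto simp: words_def linear_path_def simp del: symbs_simps dest: nonzero_subset_symbs)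

lemma path_idempotent:
  assumes "linear_path \<alpha>"
  shows "(\<alpha> @ path_inv \<alpha>) @ (\<alpha> @ path_inv \<alpha>) \<approx> \<alpha> @ path_inv \<alpha>"
  using eqv_context[OF path_inverse[OF assms], of "[]" "path_inv \<alpha>"]
    path_inv_symbs linear_path_nonzero[OF assms] by simp


lemma Obj_words: "A \<in> T0 \<Gamma> \<Longrightarrow> [Obj A] \<in> words (symbs \<Gamma>)"
  by (auto simp: words_def)

lemma nf_Rel_ne_Obj: "nf \<Gamma> (Rel t # w) \<noteq> [Obj A]"
  using lmult_Rel[of \<Gamma> t "nf \<Gamma> w"] by (auto simp: nf_Cons)

lemma nf_Rel_Rel_ne: "nf \<Gamma> (Rel t # Rel u # w) \<noteq> [Rel t, InvRel t]"
  using lmult_Rel[of \<Gamma> u "nf \<Gamma> w"] by (auto simp: nf_Cons split: if_splits)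

lemma nf_Obj: "nf \<Gamma> [Obj A] = [Obj A]"
  by (simp add: nf_def)

lemma nf_Rel_InvRel: "t \<in> rels \<Gamma> \<Longrightarrow> nf \<Gamma> [Rel t, InvRel t] = [Rel t, InvRel t]"
  using rcv_nonempty by (simp add: nf_def)

text \<open>Left multiplication by \<open>t\<close> yields \<open>0\<close> or a normal form that starts with \<open>t\<close>.\<close>

lemma Rel_path_ne_Obj:
  assumes "linear_path (Rel t # \<beta>)" "A \<in> T0 \<Gamma>"
  shows "cls \<Gamma> ((Rel t # \<beta>) @ path_inv (Rel t # \<beta>)) \<noteq> cls \<Gamma> [Obj A]"
  using cls_eq_iff[OF path_words[OF assms(1)] Obj_words[OF assms(2)]]
  by (simp add: nf_Rel_ne_Obj nf_Obj)

lemma Rel_path_le_Obj: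
  assumes "linear_path (Rel t # \<beta>)"
  shows "nat_le (Q \<Gamma>) (cls \<Gamma> ((Rel t # \<beta>) @ path_inv (Rel t # \<beta>))) (cls \<Gamma> [Obj (snd_of \<Gamma> t)])"
proof (rule eqv_nat_leI)
  let ?u = "(Rel t # \<beta>) @ path_inv (Rel t # \<beta>)"
  have t: "t \<in> rels \<Gamma>" and s: "set \<beta> \<subseteq> symbs \<Gamma>" "set (path_inv \<beta>) \<subseteq> symbs \<Gamma>"
    using linear_path_nonzero[OF assms] path_inv_symbs[of \<beta>] by auto
  show "?u \<in> words (symbs \<Gamma>)" "?u @ ?u \<approx> ?u"
    using path_words[OF assms] path_idempotent[OF assms] by auto
  show "[Obj (snd_of \<Gamma> t)] \<in> words (symbs \<Gamma>)" using t by (intro Obj_words) auto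
  show "[Obj (snd_of \<Gamma> t)] @ ?u \<approx> ?u"
    using eqv_rel_left[OF NR1_src[of "Rel t"], of "\<beta> @ path_inv \<beta> @ [InvRel t]"] t s
    by (simp add: path_inv_def)
  show "?u @ [Obj (snd_of \<Gamma> t)] \<approx> ?u"
    using eqv_context[OF eqv_rel[OF NR1_rng[of "InvRel t"]], of "Rel t # \<beta> @ path_inv \<beta>" "[]"] t s
    by (simp add: path_inv_def)
qed

text \<open>
  The first letter \<open>t\<close> absorbs \<open>t t\<^sup>-\<^sup>1\<close> on its left, and the last letter \<open>t\<^sup>-\<^sup>1\<close> absorbs it on
  its right.
\<close>

lemma Rel_path_le_Rel:
  assumes "linear_path (Rel t # \<beta>)"
  shows "nat_le (Q \<Gamma>) (cls \<Gamma> ((Rel t # \<beta>) @ path_inv (Rel t # \<beta>))) (cls \<Gamma> [Rel t, InvRel t])"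
proof (rule eqv_nat_leI)
  let ?u = "(Rel t # \<beta>) @ path_inv (Rel t # \<beta>)"
  have t: "t \<in> rels \<Gamma>" and s: "set \<beta> \<subseteq> symbs \<Gamma>" "set (path_inv \<beta>) \<subseteq> symbs \<Gamma>"
    using linear_path_nonzero[OF assms] path_inv_symbs[of \<beta>] by auto
  show "?u \<in> words (symbs \<Gamma>)" "?u @ ?u \<approx> ?u"
    using path_words[OF assms] path_idempotent[OF assms] by auto
  show "[Rel t, InvRel t] \<in> words (symbs \<Gamma>)" using t by (auto simp: words_def)
  have 1: "[Rel t, InvRel t, Rel t] \<approx> [Rel t]"
    using path_inverse[of "[Rel t]"] t by (simp add: linear_path_def path_inv_def)
  show "[Rel t, InvRel t] @ ?u \<approx> ?u"
    using eqv_context[OF 1, of "[]" "\<beta> @ path_inv \<beta> @ [InvRel t]"] t s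
    by (simp add: path_inv_def)
  have "[InvRel t, Rel t] @ [InvRel t] \<approx> [Obj (rcv_of \<Gamma> t)] @ [InvRel t]"
    using t by (intro eqv_rel_left NR4) auto
  moreover have "[Obj (rcv_of \<Gamma> t), InvRel t] \<approx> [InvRel t]"
    using eqv_rel[OF NR1_src[of "InvRel t"]] t by simp
  ultimately have 2: "[InvRel t, Rel t, InvRel t] \<approx> [InvRel t]"
    by (auto intro: pres_cong.trans)
  show "?u @ [Rel t, InvRel t] \<approx> ?u"
    using eqv_context[OF 2, of "Rel t # \<beta> @ path_inv \<beta>" "[]"] t s
    by (simp add: path_inv_def)
qed

section \<open>Maximal idempotents\<close>

lemma maximal_Obj:
  assumes "A \<in> T0 \<Gamma>"
  shows "maximal_in (nat_le (Q \<Gamma>)) (idempotents (Q \<Gamma>)) (cls \<Gamma> [Obj A])"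
  unfolding maximal_in_def
proof (intro conjI ballI impI)
  have "[Obj A] @ [Obj A] \<approx> [Obj A]"
    using eqv_rel[OF NR1_src[of "Obj A"]] assms by simp
  then show "cls \<Gamma> [Obj A] \<in> idempotents (Q \<Gamma>)"
    by (intro idempotentI Obj_words assms)
  fix f assume f: "f \<in> idempotents (Q \<Gamma>)" "nat_le (Q \<Gamma>) (cls \<Gamma> [Obj A]) f"
  then obtain w where w: "w \<in> words (symbs \<Gamma>)" "f = cls \<Gamma> w"
    by (auto simp: idempotents_def carrier_Q)
  have "cls \<Gamma> ([Obj A] @ w) = cls \<Gamma> [Obj A]"
    using nat_le_absorb[OF f(2,1)] w assms by (simp add: cls_mult Obj_words)
  then have "nf \<Gamma> ([Obj A] @ w) = nf \<Gamma> [Obj A]"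
    using cls_eq_iff[OF words_append[OF Obj_words[OF assms] w(1)] Obj_words[OF assms]] by simp
  then have "lmult \<Gamma> (Obj A) (nf \<Gamma> w) = [Obj A]"
    unfolding nf_Obj by (simp add: nf_Cons)
  then have "nf \<Gamma> w = [Obj A]"
    using nf_nonempty[OF w(1)] by (rule lmult_Obj_eq_Obj)
  then show "f = cls \<Gamma> [Obj A]"
    using w assms by (simp add: cls_eq_iff Obj_words nf_Obj)
qed

lemma maximal_Rel:
  assumes "t \<in> rels \<Gamma>"
  shows "maximal_in (nat_le (Q \<Gamma>)) (idempotents (Q \<Gamma>) - cls \<Gamma> ` T0_paths \<Gamma>) (cls \<Gamma> [Rel t, InvRel t])"
  unfolding maximal_in_def
proof (intro conjI ballI impI)
  let ?e = "[Rel t, InvRel t]"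
  have lin: "linear_path [Rel t]" and inv: "path_inv [Rel t] = [InvRel t]"
    using assms by (auto simp: linear_path_def path_inv_def)
  have e: "?e \<in> words (symbs \<Gamma>)" using path_words[OF lin] by (simp add: inv)
  show "cls \<Gamma> ?e \<in> idempotents (Q \<Gamma>) - cls \<Gamma> ` T0_paths \<Gamma>"
    using idempotentI[OF path_words path_idempotent, OF lin lin] Rel_path_ne_Obj[OF lin]
    by (auto simp: inv T0_paths_def)
  fix f assume f: "f \<in> idempotents (Q \<Gamma>) - cls \<Gamma> ` T0_paths \<Gamma>" "nat_le (Q \<Gamma>) (cls \<Gamma> ?e) f"
  then obtain w where w: "w \<in> words (symbs \<Gamma>)" "f = cls \<Gamma> w"
    by (auto simp: idempotents_def carrier_Q)
  have "cls \<Gamma> (?e @ w) = cls \<Gamma> ?e"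
    using nat_le_absorb[OF f(2)] f(1) w e by (simp add: cls_mult)
  then have "nf \<Gamma> (?e @ w) = nf \<Gamma> ?e"
    using w e by (subst (asm) cls_eq_iff) (auto simp del: append.simps intro: words_append)
  then have "lmult \<Gamma> (Rel t) (lmult \<Gamma> (InvRel t) (nf \<Gamma> w)) = ?e"
    using assms by (simp add: nf_Cons[symmetric] nf_Rel_InvRel)
  then have "nf \<Gamma> w = [Obj (snd_of \<Gamma> t)] \<or> nf \<Gamma> w = ?e"
    using w(1) assms by (intro lmult_Rel_InvRel_eq reduced_nf nf_nonempty)
  moreover have "nf \<Gamma> w \<noteq> [Obj (snd_of \<Gamma> t)]"
    using f(1) w assms cls_eq_iff[OF w(1) Obj_words[of "snd_of \<Gamma> t"]]
    by (auto simp: T0_paths_def nf_Obj)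
  ultimately show "f = cls \<Gamma> ?e"
    using w e assms by (simp add: cls_eq_iff nf_Rel_InvRel)
qed

text \<open>
  In a reduced linear path with at least two letters an object would equal the source or range of
  its neighbour, so all letters are relations; only the first two matter here.
\<close>

lemma RLP_cases:
  assumes "\<alpha> \<in> RLP \<Gamma>"
  obtains (Obj) A where "A \<in> T0 \<Gamma>" "\<alpha> = [Obj A]"
  | (Rel) t where "t \<in> rels \<Gamma>" "\<alpha> = [Rel t]"
  | (Rel_Rel) t u \<beta> where "t \<in> rels \<Gamma>" "\<alpha> = Rel t # Rel u # \<beta>"
proof (cases \<alpha> rule: remdups_adj.cases)
  case 1
  then show ?thesis using assms by (simp add: RLP_def)
next
  case (2 x)
  then show ?thesis using assms that(1,2) by (auto simp: RLP_def)
next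
  case (3 x y \<beta>)
  then have "rng \<Gamma> x = src \<Gamma> y \<and> x \<noteq> Obj (src \<Gamma> y) \<and> y \<noteq> Obj (rng \<Gamma> x)"
    using assms by (force simp: RLP_def)
  then show ?thesis using assms 3 that(3) by (auto simp: RLP_def)
qed

end

theorem lemma5p1:
  fixes \<Gamma> :: "('v, 't) network_data"
  assumes "network \<Gamma>"
  shows
    "(\<forall>\<alpha>\<in>RLP \<Gamma>.
        maximal_in (nat_le (Q \<Gamma>)) (idempotents (Q \<Gamma>)) (cls \<Gamma> (\<alpha> @ path_inv \<alpha>))
        \<longleftrightarrow> \<alpha> \<in> T0_paths \<Gamma>) \<and>
     (\<forall>\<alpha>\<in>RLP \<Gamma> - T0_paths \<Gamma>.
        maximal_in (nat_le (Q \<Gamma>)) (idempotents (Q \<Gamma>) - cls \<Gamma> ` T0_paths \<Gamma>)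
          (cls \<Gamma> (\<alpha> @ path_inv \<alpha>))
        \<longleftrightarrow> \<alpha> \<in> T_paths \<Gamma>)"
proof -
  interpret network \<Gamma> by fact
  have Rel_not_maximal:
    "\<not> maximal_in (nat_le (Q \<Gamma>)) (idempotents (Q \<Gamma>)) (cls \<Gamma> (\<alpha> @ path_inv \<alpha>))"
    if "\<alpha> \<in> RLP \<Gamma>" "t \<in> rels \<Gamma>" "\<alpha> = Rel t # \<beta>" for \<alpha> t \<beta>
  proof -
    have "linear_path (Rel t # \<beta>)" using RLP_linear that by blast
    moreover have "cls \<Gamma> [Obj (snd_of \<Gamma> t)] \<in> idempotents (Q \<Gamma>)"
      using maximal_Obj[of "snd_of \<Gamma> t"] that(2) by (auto simp: maximal_in_def)
    ultimately show ?thesis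
      using Rel_path_le_Obj[of t \<beta>] Rel_path_ne_Obj[of t \<beta> "snd_of \<Gamma> t"] that(2)
      unfolding maximal_in_def that(3) by (metis T0_simps(1))
  qed
  have Rel_Rel_not_maximal:
    "\<not> maximal_in (nat_le (Q \<Gamma>)) (idempotents (Q \<Gamma>) - cls \<Gamma> ` T0_paths \<Gamma>)
        (cls \<Gamma> (\<alpha> @ path_inv \<alpha>))"
    if "\<alpha> \<in> RLP \<Gamma>" "t \<in> rels \<Gamma>" "\<alpha> = Rel t # Rel u # \<beta>" for \<alpha> t u \<beta>
  proof -
    have lin: "linear_path (Rel t # Rel u # \<beta>)" using RLP_linear that by blast
    have "[Rel t, InvRel t] \<in> words (symbs \<Gamma>)" using that(2) by (auto simp: words_def)
    then have "cls \<Gamma> (\<alpha> @ path_inv \<alpha>) \<noteq> cls \<Gamma> [Rel t, InvRel t]"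
      using cls_eq_iff[OF path_words[OF lin]] that(2,3) by (simp add: nf_Rel_InvRel nf_Rel_Rel_ne)
    then show ?thesis
      using Rel_path_le_Rel[OF lin] maximal_Rel[OF that(2)] that(3)
      unfolding maximal_in_def by metis
  qed
  have "maximal_in (nat_le (Q \<Gamma>)) (idempotents (Q \<Gamma>)) (cls \<Gamma> (\<alpha> @ path_inv \<alpha>))
        \<longleftrightarrow> \<alpha> \<in> T0_paths \<Gamma>" if \<alpha>: "\<alpha> \<in> RLP \<Gamma>" for \<alpha>
    using \<alpha>
  proof (cases rule: RLP_cases)
    case (Obj A)
    then have "cls \<Gamma> (\<alpha> @ path_inv \<alpha>) = cls \<Gamma> [Obj A]"
      using cls_eqI[OF eqv_rel[OF NR1_src[of "Obj A" \<Gamma>]]] by (simp add: path_inv_def)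
    with Obj show ?thesis using maximal_Obj[OF Obj(1)] by (simp add: T0_paths_def)
  next
    case (Rel t)
    then have "\<alpha> \<notin> T0_paths \<Gamma>" by (auto simp: T0_paths_def)
    with Rel_not_maximal[OF \<alpha> Rel] show ?thesis by blast
  next
    case (Rel_Rel t u \<beta>)
    then have "\<alpha> \<notin> T0_paths \<Gamma>" by (auto simp: T0_paths_def)
    with Rel_not_maximal[OF \<alpha> Rel_Rel] show ?thesis by blast
  qed
  moreover have "maximal_in (nat_le (Q \<Gamma>)) (idempotents (Q \<Gamma>) - cls \<Gamma> ` T0_paths \<Gamma>)
      (cls \<Gamma> (\<alpha> @ path_inv \<alpha>)) \<longleftrightarrow> \<alpha> \<in> T_paths \<Gamma>"
    if \<alpha>: "\<alpha> \<in> RLP \<Gamma>" and nT0: "\<alpha> \<notin> T0_paths \<Gamma>" for \<alpha>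
    using \<alpha>
  proof (cases rule: RLP_cases)
    case (Obj A)
    with nT0 show ?thesis by (auto simp: T0_paths_def)
  next
    case (Rel t)
    then show ?thesis using maximal_Rel[OF Rel(1)] by (simp add: T_paths_def path_inv_def)
  next
    case (Rel_Rel t u \<beta>)
    then have "\<alpha> \<notin> T_paths \<Gamma>" by (auto simp: T_paths_def)
    with Rel_Rel_not_maximal[OF \<alpha> Rel_Rel] show ?thesis by blast
  qed
  ultimately show ?thesis by blast
qed

end
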